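(* Let $p$ be an odd prime with $p \equiv 2 \pmod 3$, and let $c$ be an integer with $2 \le c \le p-2$. For a positive integer $n$, let $M_n = [m_{ij}]_{1 \le i,j \le n}$ be the $n \times n$ matrix with entries $m_{ij} = \left[ \frac{j-i+c}{p} \right]$. Then for every $n$ with $2 \le n \le p-2$, $\det(M_n) = 0$.
   Context: For an odd prime $p$ and an integer $a$, the cubic residue symbol is defined by $\left[ \frac{a}{p} \right] = 1$ if $a \not\equiv 0 \pmod p$ and $x^3 \equiv a \pmod p$ has an integer solution; $\left[ \frac{a}{p} \right] = -1$ if $x^3 \equiv a \pmod p$ has no integer solution; and $\left[ \frac{a}{p} \right] = 0$ if $a \equiv 0 \pmod p$. *)

theory Defs
  imports "HOL-Number_Theory.Cong" "HOL-Computational_Algebra.Primes"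
    "Jordan_Normal_Form.Determinant"
begin

definition cubic_residue_symbol :: "int \<Rightarrow> nat \<Rightarrow> int" where
  "cubic_residue_symbol a p =
     (if [a = 0] (mod int p) then 0
      else if \<exists>x::int. [x ^ 3 = a] (mod int p) then 1
      else -1)"

text \<open>Matrix indices run over 0, ..., n - 1 rather than 1, ..., n; the entries depend only on
  the difference j - i, so they are unaffected by the shift.\<close>

definition cubic_residue_matrix :: "nat \<Rightarrow> int \<Rightarrow> nat \<Rightarrow> int mat" where
  "cubic_residue_matrix p c n =
     mat n n (\<lambda>(i, j). cubic_residue_symbol (int j - int i + c) p)"

end

theory Submission
  imports Defs "HOL-Number_Theory.Residues"
begin

text \<open>Since p = 2 (mod 3), every residue is a cube, so the symbol is 1 off the multiples of p
  and the matrix entry at (i, j) is 1 unless j - i + c is 0 or p.  Column indices below n force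
  i \<ge> c in the first case and i < n + c - p in the second, so the rows between the two bounds are
  constantly 1; the hypotheses leave room for at least two of them.\<close>

text \<open>Since 3 is coprime to p - 1, Fermat's little theorem makes cubing invertible on the
  units modulo p.\<close>

lemma exists_int_cube_root_cong:
  fixes p :: nat and a :: int
  assumes p: "prime p" and "[p = 2] (mod 3)"
  shows "\<exists>x::int. [x ^ 3 = a] (mod int p)"
proof (cases "int p dvd a")
  case True
  then have "[a = 0 ^ 3] (mod int p)"
    by (simp add: cong_0_iff)
  then have "[0 ^ 3 = a] (mod int p)"
    by (rule cong_sym)
  then show ?thesis ..
next
  case False
  \<comment> \<open>\<open>fermat_theorem\<close> concerns naturals, so a is replaced by its least
    nonnegative residue.\<close>
  define b where "b = nat (a mod int p)"
  have "p > 0" using p prime_gt_0_nat by blast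
  then have b: "int b = a mod int p"
    by (simp add: b_def)
  then have ba: "[int b = a] (mod int p)"
    by simp
  have "\<not> p dvd b"
    using False ba by (metis cong_dvd_iff cong_sym int_dvd_int_iff)
  then have fermat: "[b ^ (p - 1) = 1] (mod p)"
    using p fermat_theorem by blast
  obtain k where k: "p = 3 * k + 2"
  proof
    have "p mod 3 = 2"
      using assms(2) by (simp add: cong_def)
    then show "p = 3 * (p div 3) + 2"
      by presburger
  qed
  \<comment> \<open>The exponent 2k + 1 is an inverse of 3 modulo p - 1 = 3k + 1: 3(2k + 1) = 1 +
    2(p - 1).\<close>
  have "(b ^ (2 * k + 1)) ^ 3 = b * (b ^ (p - 1)) ^ 2"
    by (simp add: k algebra_simps eval_nat_numeral flip: power_mult power_add power_Suc)
  moreover have "[b * (b ^ (p - 1)) ^ 2 = b * 1 ^ 2] (mod p)"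
    by (intro cong_mult cong_pow cong_refl fermat)
  ultimately have "[(b ^ (2 * k + 1)) ^ 3 = b] (mod p)"
    by simp
  then have "[(int b ^ (2 * k + 1)) ^ 3 = int b] (mod int p)"
    by (metis cong_int_iff of_nat_power)
  then show ?thesis
    using ba cong_trans by blast
qed

lemma cubic_residue_symbol_eq_1:
  assumes "prime p" and "[p = 2] (mod 3)" and "0 < a" and "a < int p"
  shows "cubic_residue_symbol a p = 1"
proof -
  have "\<not> [a = 0] (mod int p)"
    using assms(3,4) zdvd_imp_le by (fastforce simp: cong_0_iff)
  then show ?thesis
    using exists_int_cube_root_cong [OF assms(1,2)] by (simp add: cubic_residue_symbol_def)
qed

text \<open>The bounds on i keep the argument j - i + c strictly between 0 and p: the upper one is
  used at j = 0, the lower one at j = n - 1.\<close>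

lemma row_cubic_residue_matrix_const:
  assumes "prime p" and "[p = 2] (mod 3)"
    and "i < n" and "int i < c" and "int n - int p + c \<le> int i"
  shows "row (cubic_residue_matrix p c n) i = vec n (\<lambda>_. 1)"
proof (rule eq_vecI)
  fix j assume "j < dim_vec (vec n (\<lambda>_. 1 :: int))"
  then have "j < n" by simp
  then have "cubic_residue_symbol (int j - int i + c) p = 1"
    using assms by (intro cubic_residue_symbol_eq_1) auto
  then show "row (cubic_residue_matrix p c n) i $ j = vec n (\<lambda>_. 1) $ j"
    using \<open>i < n\<close> \<open>j < n\<close> by (simp add: cubic_residue_matrix_def)
qed (simp add: cubic_residue_matrix_def)

theorem theorem3p7:
  fixes p :: nat and c :: int
  assumes "prime p" and "odd p" and "[p = 2] (mod 3)"
    and "2 \<le> c" and "c \<le> int p - 2"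
  shows "\<forall>n::nat. 2 \<le> n \<and> n \<le> p - 2 \<longrightarrow> det (cubic_residue_matrix p c n) = 0"
proof (intro allI impI)
  fix n :: nat
  assume n: "2 \<le> n \<and> n \<le> p - 2"
  \<comment> \<open>The first row of the constant block; \<open>nat\<close> truncates to 0 when n +
    c < p.\<close>
  define i where "i = nat (int n - int p + c)"
  \<comment> \<open>In the truncated case \<open>Suc i\<close> is 1, and n, c \<ge> 2 suffice.
    Otherwise \<open>Suc i\<close> = n + c - p + 1, which is below n because c \<le> p - 2 and below
    c because n \<le> p - 2.\<close>
  have bounds: "Suc i < n" "int (Suc i) < c" "int n - int p + c \<le> int i"
    using n assms(4,5) by (auto simp: i_def)
  show "det (cubic_residue_matrix p c n) = 0"
  proof (rule det_identical_rows)
    show "cubic_residue_matrix p c n \<in> carrier_mat n n"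
      by (simp add: cubic_residue_matrix_def)
    show "row (cubic_residue_matrix p c n) i = row (cubic_residue_matrix p c n) (Suc i)"
      using bounds by (simp add: row_cubic_residue_matrix_const assms(1,3))
  qed (use bounds in auto)
qed

end
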